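(* Let $A \subset \mathbb{N}$ be a random set obtained by selecting each positive integer to lie in $A$ with probability $\frac12$, these choices being made independently. Then $$\mathbb{P}\big(|\mathbb{N} \setminus (A+A)| = s\big) = (2+o(1))^{-s/2}$$ as $s \to \infty$ through the positive integers.
   Context: $\mathbb{N} = \{1,2,3,\dots\}$ and $A + A = \{a+b : a,b\in A\}$ (with $a=b$ allowed). *)

theory Defs
  imports "HOL-Probability.Probability" "HOL-Library.Set_Algebras" "HOL-Library.Landau_Symbols"
begin

end

theory Submission
  imports Defs
begin

text \<open>The lower bound comes from sets with minimum about \<open>s / 2\<close>. For the upper bound, with
  exponentially small error everything beyond \<open>n = 8 s\<close> lies in \<open>A + A\<close>, so it suffices that at
  most \<open>2 powr (n - s / 2 + o(n))\<close> sets \<open>B \<subseteq> {1..n}\<close> have at least \<open>s\<close> elements of \<open>{1..2 n}\<close>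
  outside \<open>B + B\<close>. The pairs \<open>(B, S)\<close> with \<open>S\<close> disjoint from \<open>B + B\<close> are covered by
  \<open>2 powr o(n)\<close> containers \<open>(W, T)\<close> having only \<open>o(n\<^sup>2)\<close> solutions of \<open>x + y = z\<close> with
  \<open>x, y \<in> W\<close> and \<open>z \<in> T\<close>. A robust form of \<open>|W + W| \<ge> 2 |W| - 1\<close> then gives
  \<open>2 |W| + |T| \<le> 2 n + o(n)\<close>, hence \<open>|W| \<le> n - s / 2 + o(n)\<close> whenever \<open>|T| \<ge> s\<close>.\<close>

section \<open>Supersaturation for sums of integers\<close>

definition sum_pairs :: "nat set \<Rightarrow> nat set \<Rightarrow> (nat \<times> nat) set" where
  "sum_pairs W T = {(x, y). x \<in> W \<and> y \<in> W \<and> x + y \<in> T}"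

lemma finite_sum_pairs: "finite W \<Longrightarrow> finite (sum_pairs W T)"
  by (rule finite_subset[of _ "W \<times> W"]) (auto simp: sum_pairs_def)

text \<open>With a = \<open>Min W\<close> and b = \<open>Max W\<close>, the translates a + W and b +
  W meet only in a + b, so together they contain 2|W| - 1 sums, all in \<open>{1..2 * n}\<close>. By
  counting, at least 2|W| - 1 + |T| - 2n of these lie in T, and each supplies a pair that disappears
  with the two extremes.\<close>

lemma card_sum_pairs_remove_extremes:
  assumes W: "finite W" "W \<noteq> {}" and T: "T \<subseteq> {1..2 * n}" and Wn: "W \<subseteq> {1..n}"
  shows "2 * int (card W) + int (card T) - 2 * int n - 1 + int (card (sum_pairs (W - {Min W, Max W}) T))
    \<le> int (card (sum_pairs W T))"
proof -
  define a b where "a = Min W" and "b = Max W"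
  have ab: "a \<in> W" "b \<in> W" and bnd: "\<And>x. x \<in> W \<Longrightarrow> a \<le> x \<and> x \<le> b"
    using W by (auto simp: a_def b_def)
  define Q where "Q = (+) a ` W \<union> (+) b ` W"
  have "(+) a ` W \<inter> (+) b ` W = {a + b}"
  proof
    show "(+) a ` W \<inter> (+) b ` W \<subseteq> {a + b}"
    proof
      fix z assume "z \<in> (+) a ` W \<inter> (+) b ` W"
      then obtain x y where "x \<in> W" "y \<in> W" "z = a + x" "z = b + y" by auto
      then show "z \<in> {a + b}" using bnd[of x] bnd[of y] by auto
    qed
    show "{a + b} \<subseteq> (+) a ` W \<inter> (+) b ` W" using ab by (auto simp: image_iff intro: bexI)
  qed
  then have cQ: "card Q + 1 = 2 * card W"
    using card_Un_Int[of "(+) a ` W" "(+) b ` W"] W by (simp add: Q_def card_image)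
  have "x + y \<in> {1..2 * n}" if "x \<in> W" "y \<in> W" for x y
    using subsetD[OF Wn that(1)] subsetD[OF Wn that(2)] by simp
  then have Qn: "Q \<subseteq> {1..2 * n}" using ab unfolding Q_def by blast
  have finQT: "finite Q" "finite T" using finite_subset[OF Qn] finite_subset[OF T] by simp_all
  have "card Q + card T = card (Q \<union> T) + card (Q \<inter> T)"
    by (rule card_Un_Int[OF finQT])
  moreover have "card (Q \<union> T) \<le> card {1..2 * n}"
    by (rule card_mono) (use Qn T in auto)
  ultimately have cQT: "int (card (Q \<inter> T)) \<ge> 2 * int (card W) + int (card T) - 2 * int n - 1"
    using cQ by simp
  \<comment> \<open>Sums in a + W are at most a + b and those in b + W at least a + b, so comparing
    z with a + b finds a decomposition of z that uses an extreme. \<open>g\<close> is injective on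
    \<open>Q\<close> because z is the sum of its coordinates.\<close>
  define g where "g z = (if z \<le> a + b then (a, z - a) else (z - b, b))" for z
  let ?W' = "W - {a, b}"
  have "z = fst (g z) + snd (g z)" if "z \<in> Q" for z
  proof -
    have "a \<le> z" using that by (auto simp: Q_def dest: bnd)
    then show ?thesis by (auto simp: g_def)
  qed
  then have inj: "inj_on g (Q \<inter> T)" by (metis IntD1 inj_onI)
  have sub: "g ` (Q \<inter> T) \<subseteq> sum_pairs W T - sum_pairs ?W' T"
  proof
    fix p assume "p \<in> g ` (Q \<inter> T)"
    then obtain z where z: "z \<in> Q" "z \<in> T" "p = g z" by auto
    from z(1) consider x where "x \<in> W" "z = a + x" | x where "x \<in> W" "z = b + x"
      by (auto simp: Q_def)
    then show "p \<in> sum_pairs W T - sum_pairs ?W' T"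
    proof cases
      case 1
      then show ?thesis using bnd[of x] z ab by (auto simp: g_def sum_pairs_def)
    next
      case 2
      then show ?thesis using bnd[of x] z ab
        by (cases "x = a") (auto simp: g_def sum_pairs_def add.commute)
    qed
  qed
  have "card (Q \<inter> T) \<le> card (sum_pairs W T - sum_pairs ?W' T)"
    using card_mono[OF _ sub] card_image[OF inj] W(1) by (simp add: finite_sum_pairs)
  also have "\<dots> = card (sum_pairs W T) - card (sum_pairs ?W' T)"
    by (rule card_Diff_subset) (use W in \<open>auto simp: finite_sum_pairs\<close>, auto simp: sum_pairs_def)
  finally have "card (Q \<inter> T) \<le> card (sum_pairs W T) - card (sum_pairs ?W' T)" .
  moreover have "card (sum_pairs ?W' T) \<le> card (sum_pairs W T)"
    by (rule card_mono) (use W in \<open>auto simp: finite_sum_pairs\<close>, auto simp: sum_pairs_def)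
  ultimately show ?thesis using cQT unfolding a_def b_def by linarith
qed

text \<open>For K > 2, deleting the two extremes lowers K by 4 and destroys at least K - 1 pairs,
  while the target \<open>K * (K - 2)\<close> drops by 8 (K - 3), which is below 8 (K - 1). K = 3 is
  treated directly, since K - 4 would be negative.\<close>

lemma sum_pairs_supersaturation:
  assumes "W \<subseteq> {1..n}" "T \<subseteq> {1..2 * n}"
    and "K = 2 * int (card W) + int (card T) - 2 * int n" "K \<ge> 0"
  shows "K * (K - 2) \<le> 8 * int (card (sum_pairs W T))"
  using assms
proof (induction "card W" arbitrary: W K rule: less_induct)
  case less
  have finW: "finite W" using less.prems finite_subset by blast
  have cT: "card T \<le> 2 * n" using card_mono[OF _ less.prems(2)] by simp
  show ?case
  proof (cases "K \<le> 2")
    case True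
    then have "K * (K - 2) \<le> 0" using less.prems(4) by (simp add: mult_nonneg_nonpos)
    then show ?thesis by linarith
  next
    case False
    then have c2: "card W \<ge> 2" using cT less.prems(3) by linarith
    then have ne: "W \<noteq> {}" by auto
    have "Min W \<noteq> Max W"
    proof
      assume "Min W = Max W"
      then have "W \<subseteq> {Min W}" using finW by (metis Max_ge Min_le antisym singletonI subsetI)
      then show False using c2 card_mono[of "{Min W}" W] by simp
    qed
    let ?W' = "W - {Min W, Max W}"
    have c': "card ?W' = card W - 2"
      using finW ne \<open>Min W \<noteq> Max W\<close> by (subst card_Diff_subset) auto
    have step: "K - 1 + int (card (sum_pairs ?W' T)) \<le> int (card (sum_pairs W T))"
      using card_sum_pairs_remove_extremes[OF finW ne less.prems(2,1)] less.prems(3) by simp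
    show ?thesis
    proof (cases "K = 3")
      case True
      then show ?thesis using step by simp
    next
      case False
      have "(K - 4) * (K - 4 - 2) \<le> 8 * int (card (sum_pairs ?W' T))"
        by (rule less.hyps) (use c' c2 less.prems False \<open>\<not> K \<le> 2\<close> in auto)
      then show ?thesis using step by (simp add: algebra_simps)
    qed
  qed
qed

section \<open>Containers for a set and the complement of its sumset\<close>

definition avoids :: "nat set \<Rightarrow> nat set \<Rightarrow> bool" where
  "avoids A S \<longleftrightarrow> (A + A) \<inter> S = {}"

lemma card_pairs_eq_sum_row:
  assumes "finite D" "finite W"
  shows "card {(x, y). x \<in> D \<and> y \<in> W \<and> x + y \<in> T} = (\<Sum>x\<in>D. card {y \<in> W. x + y \<in> (T::nat set)})"
proof -
  have "{(x, y). x \<in> D \<and> y \<in> W \<and> x + y \<in> T} = Sigma D (\<lambda>x. {y \<in> W. x + y \<in> T})" by auto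
  then show ?thesis using assms by simp
qed

lemma card_pairs_eq_sum_col:
  assumes "finite D" "finite W"
  shows "card {(x, y). x \<in> D \<and> y \<in> W \<and> x + y \<in> T} = (\<Sum>y\<in>W. card {x \<in> D. x + y \<in> (T::nat set)})"
proof -
  have "{(x, y). x \<in> D \<and> y \<in> W \<and> x + y \<in> T} = prod.swap ` Sigma W (\<lambda>y. {x \<in> D. x + y \<in> T})"
    by (auto simp: image_iff)
  then show ?thesis using assms by (simp add: card_image)
qed

text \<open>F is taken of largest size among the subsets of A for which D + F covers at least
  \<open>card F * \<kappa>\<close> elements of T. An element y of A with \<kappa> or more uncovered
  elements of T in D + y could be added to F, contradicting maximality.\<close>

lemma obtain_fingerprint:
  fixes A D T :: "nat set" and \<kappa> :: real
  assumes fin: "finite A" "finite T" and \<kappa>: "\<kappa> > 0"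
  obtains F where "F \<subseteq> A" "card F * \<kappa> \<le> card T"
    "\<And>y. y \<in> A \<Longrightarrow> card {x \<in> D. x + y \<in> T - (D + F)} < \<kappa>"
proof -
  define P where "P F \<longleftrightarrow> F \<subseteq> A \<and> card F * \<kappa> \<le> card (T \<inter> (D + F))" for F
  have "P {}" by (simp add: P_def)
  moreover have "\<forall>F. P F \<longrightarrow> card F < Suc (card A)"
    using card_mono[OF fin(1)] by (auto simp: P_def less_Suc_eq_le)
  ultimately have "\<exists>F. P F \<and> (\<forall>G. P G \<longrightarrow> card G \<le> card F)"
    by (rule Lattices_Big.ex_has_greatest_nat)
  then obtain F where F: "P F" "\<And>G. P G \<Longrightarrow> card G \<le> card F"
    by blast
  have FA: "F \<subseteq> A" and finF: "finite F" using F(1) fin finite_subset by (auto simp: P_def)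
  have "card {x \<in> D. x + y \<in> T - (D + F)} < \<kappa>" if y: "y \<in> A" for y
  proof (rule ccontr)
    let ?N = "{x \<in> D. x + y \<in> T - (D + F)}"
    assume "\<not> card ?N < \<kappa>"
    then have N: "card ?N \<ge> \<kappa>" by simp
    have "?N \<noteq> {}"
    proof
      assume "?N = {}"
      then show False using N \<kappa> by (metis card.empty not_less of_nat_0)
    qed
    then have yF: "y \<notin> F" by (auto simp: set_plus_def)
    have "card (T \<inter> (D + F)) + card ?N = card (T \<inter> (D + F)) + card ((\<lambda>x. x + y) ` ?N)"
      by (simp add: card_image)
    also have "\<dots> = card (T \<inter> (D + F) \<union> (\<lambda>x. x + y) ` ?N)"
      by (rule card_Un_disjoint[symmetric]) (use fin in \<open>auto intro: finite_subset[of _ T]\<close>)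
    also have "\<dots> \<le> card (T \<inter> (D + insert y F))"
      by (rule card_mono) (use fin in \<open>auto simp: set_plus_def\<close>)
    finally have "card (insert y F) * \<kappa> \<le> card (T \<inter> (D + insert y F))"
      using N F(1) yF finF by (simp add: P_def algebra_simps)
    then have "P (insert y F)" using FA y by (simp add: P_def)
    then show False using F(2)[of "insert y F"] yF finF by simp
  qed
  moreover have "card F * \<kappa> \<le> card T"
    using F(1) card_mono[OF fin(2), of "T \<inter> (D + F)"] unfolding P_def
    by (meson Int_lower1 of_nat_le_iff order_trans)
  ultimately show ?thesis using that FA by blast
qed

text \<open>The container of a pair \<open>(A, S)\<close>. If \<open>A\<close> has fewer than \<open>d\<close> elements of high degree, \<open>D\<close>
  lists them and the others are deleted. Otherwise \<open>D\<close> consists of \<open>d\<close> such elements, and \<open>F \<subseteq> A\<close>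
  is a maximal greedy fingerprint for the bipartite graph joining \<open>y \<in> W\<close> to \<open>D + y\<close>.\<close>
definition container ::
  "real \<Rightarrow> nat \<Rightarrow> nat \<Rightarrow> nat set \<Rightarrow> nat set \<Rightarrow> nat set \<Rightarrow> nat set \<Rightarrow> nat set \<times> nat set" where
  "container \<delta> n d W T D F =
    (if card D < d then (W - {x \<in> W. 2 * real (card {y \<in> W. x + y \<in> T}) \<ge> \<delta> * n} \<union> D, T)
     else ({y \<in> W. card {x \<in> D. x + y \<in> T - (D + F)} < \<delta> * d / 8}, T - (D + F)))"

text \<open>While many pairs remain, a few elements of A determine a strictly smaller pair that
  still contains \<open>(A, S)\<close>. The new pair depends on A and S only through D and F, which
  is what makes the containers countable.\<close>

lemma container_step:
  fixes \<delta> :: real and n d r :: nat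
  assumes \<delta>: "\<delta> > 0" and d: "d > 0" "d \<le> r" "d \<le> \<delta> * n / 4" and r: "16 * n \<le> \<delta> * d * r"
    and W: "W \<subseteq> {1..n}" and T: "T \<subseteq> {1..2 * n}"
    and e: "card (sum_pairs W T) > \<delta> * n ^ 2"
    and A: "A \<subseteq> W" "S \<subseteq> T" "avoids A S"
  shows "\<exists>D F W' T'. D \<subseteq> {1..n} \<and> card D \<le> r \<and> F \<subseteq> {1..n} \<and> card F \<le> r \<and>
    container \<delta> n d W T D F = (W', T') \<and> A \<subseteq> W' \<and> S \<subseteq> T' \<and> W' \<subseteq> W \<and> T' \<subseteq> T \<and>
    card W' + card T' \<le> card W + card T - \<delta> * n / 4"
proof -
  have finW: "finite W" and finT: "finite T" using W T finite_subset by blast+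
  have finA: "finite A" using A finW finite_subset by blast
  have cW: "card W \<le> n" using card_mono[OF _ W] by simp
  have cT: "card T \<le> 2 * n" using card_mono[OF _ T] by simp
  define X where "X = {x \<in> W. 2 * real (card {y \<in> W. x + y \<in> T}) \<ge> \<delta> * n}"
  have XW: "X \<subseteq> W" by (auto simp: X_def)
  show ?thesis
  proof (cases "card (A \<inter> X) < d")
    case True
    let ?D = "A \<inter> X"
    let ?W' = "W - X \<union> ?D"
    \<comment> \<open>Elements outside X start at most n (\<delta> n / 2) pairs, so more than half
      of \<delta> n^2 pairs start in X. Each degree is at most n, hence |X| > \<delta> n / 2. Since
      fewer than d \<le> \<delta> n / 4 elements of X are kept, the required drop follows.\<close>
    have "real (card (sum_pairs W T)) = (\<Sum>x\<in>W. card {y \<in> W. x + y \<in> T})"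
      using card_pairs_eq_sum_row[OF finW finW] by (simp add: sum_pairs_def)
    also have "\<dots> = (\<Sum>x\<in>W - X. real (card {y \<in> W. x + y \<in> T})) + (\<Sum>x\<in>X. card {y \<in> W. x + y \<in> T})"
      by (simp add: sum.subset_diff[OF XW finW])
    also have "\<dots> \<le> (\<Sum>x\<in>W - X. \<delta> * n / 2) + (\<Sum>x\<in>X. real n)"
    proof (intro add_mono)
      show "(\<Sum>x\<in>W - X. real (card {y \<in> W. x + y \<in> T})) \<le> (\<Sum>x\<in>W - X. \<delta> * n / 2)"
        by (rule sum_mono) (auto simp: X_def)
      have "card {y \<in> W. x + y \<in> T} \<le> n" for x
        using card_mono[OF finW, of "{y \<in> W. x + y \<in> T}"] cW by auto
      then show "real (\<Sum>x\<in>X. card {y \<in> W. x + y \<in> T}) \<le> (\<Sum>x\<in>X. real n)"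
        unfolding of_nat_sum by (intro sum_mono) simp
    qed
    also have "\<dots> \<le> n * (\<delta> * n / 2) + card X * real n"
    proof -
      have "card (W - X) \<le> n" using cW finW card_mono[of W "W - X"] by auto
      then show ?thesis using \<delta> by (simp add: mult_right_mono)
    qed
    finally have "real n * (\<delta> * n / 2) < real n * card X"
      using e by (simp add: power2_eq_square algebra_simps)
    then have cX: "\<delta> * n / 2 < card X"
      by (rule mult_left_less_imp_less) simp
    have "card ?W' = card (W - X) + card ?D"
      by (rule card_Un_disjoint) (use finW finA in auto)
    also have "card (W - X) = card W - card X"
      using finW XW finite_subset by (intro card_Diff_subset) auto
    finally have "real (card ?W') = card W - real (card X) + card ?D"
      using card_mono[OF finW XW] by simp
    then have "card ?W' + card T \<le> card W + card T - \<delta> * n / 4"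
      using cX d(3) True by simp
    moreover have "container \<delta> n d W T ?D {} = (?W', T)"
      using True by (simp add: container_def X_def)
    moreover have "A \<subseteq> ?W'" "?W' \<subseteq> W" "?D \<subseteq> {1..n}" "{} \<subseteq> {1..n}" "card ?D \<le> r"
      "card {} \<le> r" using A W XW True d(2) by auto
    ultimately show ?thesis using A(2) by blast
  next
    case False
    then obtain D where D: "D \<subseteq> A \<inter> X" "card D = d" "finite D"
      using obtain_subset_with_card_n[of d "A \<inter> X"] by (metis not_less)
    \<comment> \<open>D has at least d \<delta> n / 2 edges, and this threshold leaves at most n
      \<kappa>, a quarter of that number, between W' and T'. It also bounds the fingerprint: |F|
      \<le> 2n / \<kappa> = 16n / (\<delta> d) \<le> r.\<close>
    define \<kappa> where "\<kappa> = \<delta> * d / 8"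
    have \<kappa>: "\<kappa> > 0" using \<delta> d by (simp add: \<kappa>_def)
    obtain F where F: "F \<subseteq> A" "card F * \<kappa> \<le> card T"
      "\<And>y. y \<in> A \<Longrightarrow> card {x \<in> D. x + y \<in> T - (D + F)} < \<kappa>"
      using obtain_fingerprint[OF finA finT \<kappa>] by blast
    define T' where "T' = T - (D + F)"
    define W' where "W' = {y \<in> W. card {x \<in> D. x + y \<in> T'} < \<kappa>}"
    have sub: "W' \<subseteq> W" "T' \<subseteq> T" and finW': "finite W'" and finT': "finite T'"
      using finW finT by (auto simp: W'_def T'_def)
    have "card F * \<kappa> \<le> 2 * n" using F(2) cT by linarith
    also have "\<dots> \<le> r * \<kappa>" using r by (simp add: \<kappa>_def mult_ac)
    finally have cF: "card F \<le> r" using \<kappa> by simp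
    define E where "E W T = {(x, y). x \<in> D \<and> y \<in> W \<and> x + y \<in> T}" for W T :: "nat set"
    have finE: "finite (E W T)" if "finite W" for W T
      by (rule finite_subset[of _ "D \<times> W"]) (use D that in \<open>auto simp: E_def\<close>)
    have "d * (\<delta> * n / 2) = (\<Sum>x\<in>D. \<delta> * n / 2)" by (simp add: D)
    also have "\<dots> \<le> (\<Sum>x\<in>D. real (card {y \<in> W. x + y \<in> T}))"
      by (rule sum_mono) (use D in \<open>auto simp: X_def\<close>)
    also have "\<dots> = card (E W T)"
      using card_pairs_eq_sum_row[OF D(3) finW] by (simp add: E_def)
    \<comment> \<open>Every edge uses a deleted element of W, or a deleted element of T, or
      survives. A deleted element meets at most d edges, so destroying three quarters of the edges
      takes at least 3 \<delta> n / 8 deletions.\<close>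
    also have "\<dots> \<le> real (card (E (W - W') T)) + card (E W (T - T')) + card (E W' T')"
    proof -
      have "card (E W T) \<le> card (E (W - W') T \<union> E W (T - T') \<union> E W' T')"
        by (rule card_mono) (simp add: finE finW finW', auto simp: E_def)
      also have "\<dots> \<le> card (E (W - W') T) + card (E W (T - T')) + card (E W' T')"
        by (meson card_Un_le add_le_mono1 order_trans)
      finally show ?thesis by linarith
    qed
    also have "\<dots> \<le> d * real (card (W - W')) + d * real (card (T - T')) + n * \<kappa>"
    proof (intro add_mono)
      have "card (E (W - W') T) \<le> card (D \<times> (W - W'))"
        by (rule card_mono) (use D finW in \<open>auto simp: E_def\<close>)
      then show "real (card (E (W - W') T)) \<le> d * real (card (W - W'))"
        unfolding card_cartesian_product D(2) of_nat_mult[symmetric] of_nat_le_iff .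
      have "card (E W (T - T')) \<le> card (D \<times> (T - T'))"
      proof (rule card_inj_on_le[of "\<lambda>(x, y). (x, x + y)"])
        show "inj_on (\<lambda>(x, y). (x, x + y)) (E W (T - T'))" by (auto simp: inj_on_def)
      qed (use D finT in \<open>auto simp: E_def\<close>)
      then show "real (card (E W (T - T'))) \<le> d * real (card (T - T'))"
        unfolding card_cartesian_product D(2) of_nat_mult[symmetric] of_nat_le_iff .
      have "real (card (E W' T')) = (\<Sum>y\<in>W'. real (card {x \<in> D. x + y \<in> T'}))"
        using card_pairs_eq_sum_col[OF D(3) finW'] by (simp add: E_def)
      also have "\<dots> \<le> (\<Sum>y\<in>W'. \<kappa>)" by (rule sum_mono) (auto simp: W'_def)
      also have "\<dots> \<le> n * \<kappa>"
      proof -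
        have "card W' \<le> n" using cW card_mono[OF finW sub(1)] by simp
        then show ?thesis using \<kappa> by simp
      qed
      finally show "real (card (E W' T')) \<le> n * \<kappa>" .
    qed
    finally have "real d * (3 * \<delta> * n / 8) \<le> d * (real (card (W - W')) + card (T - T'))"
      by (simp add: \<kappa>_def algebra_simps)
    then have drop: "3 * \<delta> * n / 8 \<le> real (card (W - W')) + card (T - T')"
      using d(1) by (subst (asm) mult_le_cancel_left_pos) auto
    have "card (W - W') = card W - card W'" "card W' \<le> card W"
      using finW finW' sub by (auto intro!: card_Diff_subset card_mono)
    moreover have "card (T - T') = card T - card T'" "card T' \<le> card T"
      using finT finT' sub by (auto intro!: card_Diff_subset card_mono)
    moreover have "\<delta> * n \<ge> 0" using \<delta> by simp
    ultimately have "card W' + card T' \<le> card W + card T - \<delta> * n / 4"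
      using drop by simp
    moreover have "container \<delta> n d W T D F = (W', T')"
      using D by (simp add: container_def \<kappa>_def W'_def T'_def)
    moreover have "A \<subseteq> W'" using A F(3) by (auto simp: W'_def T'_def)
    \<comment> \<open>Both D and F are subsets of A, so D + F lies in A + A, which S avoids.
      Deleting D + F from T therefore loses nothing of S.\<close>
    moreover have "S \<inter> (D + F) = {}"
      using A(3) D(1) F(1) set_plus_mono2[of D A F A] unfolding avoids_def by blast
    then have "S \<subseteq> T'" using A(2) by (auto simp: T'_def)
    moreover have "D \<subseteq> {1..n}" "card D \<le> r" "F \<subseteq> {1..n}" using A W D d(2) F(1) by auto
    ultimately show ?thesis using sub cF by blast
  qed
qed

section \<open>Counting sets whose sumset misses many integers\<close>

definition small_subsets :: "nat \<Rightarrow> nat \<Rightarrow> nat set set" where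
  "small_subsets n r = {D. D \<subseteq> {1..n} \<and> card D \<le> r}"

lemma finite_small_subsets [simp]: "finite (small_subsets n r)"
  by (simp add: small_subsets_def)

lemma sum_Pow_power_card:
  fixes x :: real
  assumes "finite S"
  shows "(\<Sum>D\<in>Pow S. x ^ card D) = (1 + x) ^ card S"
  using assms
proof (induction S rule: finite_induct)
  case (insert a S)
  have "(\<Sum>D\<in>Pow (insert a S). x ^ card D) =
      (\<Sum>D\<in>Pow S. x ^ card D) + (\<Sum>D\<in>insert a ` Pow S. x ^ card D)"
    unfolding Pow_insert by (rule sum.union_disjoint) (use insert in auto)
  also have "(\<Sum>D\<in>insert a ` Pow S. x ^ card D) = (\<Sum>D\<in>Pow S. x ^ card (insert a D))"
    by (rule sum.reindex_cong[of "insert a"]) (use insert in \<open>auto simp: inj_on_def\<close>)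
  also have "\<dots> = (\<Sum>D\<in>Pow S. x * x ^ card D)"
  proof (rule sum.cong)
    fix D assume "D \<in> Pow S"
    then have "finite D" "a \<notin> D" using insert finite_subset by auto
    then show "x ^ card (insert a D) = x * x ^ card D" by simp
  qed simp
  finally show ?case using insert by (simp add: sum_distrib_left[symmetric] algebra_simps)
qed simp

text \<open>Weight each subset D of \<open>{1..n}\<close> by \<open>x ^ card D\<close>. All weights
  together sum to \<open>(1 + x) ^ n\<close>, and since x \<le> 1 each small subset weighs at least
  \<open>x ^ r\<close>.\<close>

lemma card_small_subsets_le:
  fixes x :: real
  assumes "0 < x" "x \<le> 1"
  shows "card (small_subsets n r) \<le> (1 + x) ^ n / x ^ r"
proof -
  have "card (small_subsets n r) * x ^ r = (\<Sum>D\<in>small_subsets n r. x ^ r)" by simp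
  also have "\<dots> \<le> (\<Sum>D\<in>small_subsets n r. x ^ card D)"
    by (rule sum_mono) (use assms in \<open>auto simp: small_subsets_def intro: power_decreasing\<close>)
  also have "\<dots> \<le> (\<Sum>D\<in>Pow {1..n}. x ^ card D)"
    by (rule sum_mono2) (use assms in \<open>auto simp: small_subsets_def\<close>)
  also have "\<dots> = (1 + x) ^ n" using sum_Pow_power_card[of "{1..n}" x] by simp
  finally show ?thesis using assms by (simp add: field_simps)
qed

text \<open>This iterates \<open>container_step\<close>. Each round branches over pairs (D, F) of
  small subsets and lowers |W| + |T| by \<delta> n / 4, so k bounds the depth of the tree. When the
  budget is exhausted W is empty and no pairs remain.\<close>

lemma container_family:
  fixes \<delta> :: real and n d r k :: nat
  assumes \<delta>: "\<delta> > 0" and d: "d > 0" "d \<le> r" "d \<le> \<delta> * n / 4" and r: "16 * n \<le> \<delta> * d * r"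
    and W: "W \<subseteq> {1..n}" and T: "T \<subseteq> {1..2 * n}"
    and k: "card W + card T \<le> k * (\<delta> * n / 4)"
  shows "\<exists>\<C>. finite \<C> \<and> card \<C> \<le> (card (small_subsets n r) ^ 2) ^ k \<and>
    (\<forall>(W', T')\<in>\<C>. W' \<subseteq> W \<and> T' \<subseteq> T \<and> card (sum_pairs W' T') \<le> \<delta> * n ^ 2) \<and>
    (\<forall>A S. A \<subseteq> W \<longrightarrow> S \<subseteq> T \<longrightarrow> avoids A S \<longrightarrow> (\<exists>(W', T')\<in>\<C>. A \<subseteq> W' \<and> S \<subseteq> T'))"
  using W T k
proof (induction k arbitrary: W T)
  case 0
  have "real (card W) + real (card T) \<le> 0" using 0(3) by simp
  then have "card W = 0" by linarith
  then have "W = {}" using finite_subset[OF 0(1)] by simp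
  then have "sum_pairs W T = {}" by (simp add: sum_pairs_def)
  then show ?case using \<delta> by (intro exI[of _ "{(W, T)}"]) auto
next
  case (Suc k)
  let ?P = "small_subsets n r"
  have "{} \<in> ?P" by (simp add: small_subsets_def)
  then have P1: "card ?P \<ge> 1" using card_gt_0_iff[of ?P] finite_small_subsets[of n r] by auto
  show ?case
  proof (cases "card (sum_pairs W T) \<le> \<delta> * n ^ 2")
    case True
    have "1 \<le> (card ?P ^ 2) ^ Suc k" using P1 by (intro one_le_power)
    then show ?thesis using True by (intro exI[of _ "{(W, T)}"]) auto
  next
    case False
    \<comment> \<open>The children of (W, T). An arbitrary choice of D and F need not shrink the
      pair, so only the containers within the reduced budget are kept and the induction hypothesis
      applies to each of them.\<close>
    define \<G> where "\<G> = {g \<in> (\<lambda>(D, F). container \<delta> n d W T D F) ` (?P \<times> ?P).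
      fst g \<subseteq> W \<and> snd g \<subseteq> T \<and> card (fst g) + card (snd g) \<le> k * (\<delta> * n / 4)}"
    have \<G>: "fst g \<subseteq> W \<and> snd g \<subseteq> T \<and> card (fst g) + card (snd g) \<le> k * (\<delta> * n / 4)"
      if "g \<in> \<G>" for g
      using that unfolding \<G>_def by blast
    have fG: "finite \<G>" unfolding \<G>_def
      by (rule finite_subset[of _ "(\<lambda>(D, F). container \<delta> n d W T D F) ` (?P \<times> ?P)"]) auto
    have "card \<G> \<le> card ((\<lambda>(D, F). container \<delta> n d W T D F) ` (?P \<times> ?P))"
      unfolding \<G>_def by (rule card_mono) auto
    also have "\<dots> \<le> card (?P \<times> ?P)" by (rule card_image_le) simp
    finally have cG: "card \<G> \<le> card ?P ^ 2" by (simp add: power2_eq_square)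
    \<comment> \<open>Naming the induction conclusion allows one family to be chosen for every child
      at once.\<close>
    define Q where "Q W T \<C> \<longleftrightarrow> finite \<C> \<and> card \<C> \<le> (card ?P ^ 2) ^ k \<and>
      (\<forall>(W', T')\<in>\<C>. W' \<subseteq> W \<and> T' \<subseteq> T \<and> card (sum_pairs W' T') \<le> \<delta> * n ^ 2) \<and>
      (\<forall>A S. A \<subseteq> W \<longrightarrow> S \<subseteq> T \<longrightarrow> avoids A S \<longrightarrow> (\<exists>(W', T')\<in>\<C>. A \<subseteq> W' \<and> S \<subseteq> T'))"
      for W T \<C>
    have "\<exists>\<C>. Q (fst g) (snd g) \<C>" if "g \<in> \<G>" for g
      unfolding Q_def by (rule Suc.IH) (use \<G>[OF that] Suc.prems in blast)+
    then obtain \<C> where \<C>: "\<And>g. g \<in> \<G> \<Longrightarrow> Q (fst g) (snd g) (\<C> g)" by metis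
    have 1: "finite (\<Union>g\<in>\<G>. \<C> g)" using fG \<C> by (auto simp: Q_def)
    have "card (\<Union>g\<in>\<G>. \<C> g) \<le> (\<Sum>g\<in>\<G>. card (\<C> g))" by (rule card_UN_le[OF fG])
    also have "\<dots> \<le> (\<Sum>g\<in>\<G>. (card ?P ^ 2) ^ k)" by (rule sum_mono) (use \<C> in \<open>auto simp: Q_def\<close>)
    also have "\<dots> \<le> (card ?P ^ 2) ^ Suc k" using cG by simp
    finally have 2: "card (\<Union>g\<in>\<G>. \<C> g) \<le> (card ?P ^ 2) ^ Suc k" .
    have 3: "W' \<subseteq> W \<and> T' \<subseteq> T \<and> card (sum_pairs W' T') \<le> \<delta> * n ^ 2"
      if "(W', T') \<in> \<C> g" "g \<in> \<G>" for W' T' g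
    proof -
      have "W' \<subseteq> fst g \<and> T' \<subseteq> snd g \<and> card (sum_pairs W' T') \<le> \<delta> * n ^ 2"
        using \<C>[OF that(2)] that(1) unfolding Q_def by blast
      moreover have "fst g \<subseteq> W" "snd g \<subseteq> T" using \<G>[OF that(2)] by auto
      ultimately show ?thesis by blast
    qed
    have 4: "\<exists>g\<in>\<G>. \<exists>(W', T')\<in>\<C> g. A \<subseteq> W' \<and> S \<subseteq> T'"
      if A: "A \<subseteq> W" "S \<subseteq> T" "avoids A S" for A S
    proof -
      have "card (sum_pairs W T) > \<delta> * n ^ 2" using False by simp
      from container_step[OF \<delta> d r Suc.prems(1,2) this A] obtain D F W' T' where
        D: "D \<subseteq> {1..n}" "card D \<le> r" "F \<subseteq> {1..n}" "card F \<le> r" "container \<delta> n d W T D F = (W', T')"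
        and sub: "A \<subseteq> W'" "S \<subseteq> T'" "W' \<subseteq> W" "T' \<subseteq> T"
        and drop: "card W' + card T' \<le> card W + card T - \<delta> * n / 4"
        by blast
      have "card W' + card T' \<le> k * (\<delta> * n / 4)"
        using drop Suc.prems(3) by (simp add: algebra_simps)
      moreover have "(W', T') \<in> (\<lambda>(D, F). container \<delta> n d W T D F) ` (?P \<times> ?P)"
        by (rule image_eqI[of _ _ "(D, F)"]) (use D in \<open>auto simp: small_subsets_def\<close>)
      ultimately have g: "(W', T') \<in> \<G>" using sub by (auto simp: \<G>_def)
      have "\<exists>(W'', T'')\<in>\<C> (W', T'). A \<subseteq> W'' \<and> S \<subseteq> T''"
        using \<C>[OF g] sub A(3) by (simp add: Q_def)
      then show ?thesis using g by blast
    qed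
    have 5: "\<forall>(W', T')\<in>(\<Union>g\<in>\<G>. \<C> g). W' \<subseteq> W \<and> T' \<subseteq> T \<and> card (sum_pairs W' T') \<le> \<delta> * n ^ 2"
    proof
      fix h assume "h \<in> (\<Union>g\<in>\<G>. \<C> g)"
      then obtain g where "g \<in> \<G>" "(fst h, snd h) \<in> \<C> g" by auto
      then show "case h of (W', T') \<Rightarrow> W' \<subseteq> W \<and> T' \<subseteq> T \<and> card (sum_pairs W' T') \<le> \<delta> * n ^ 2"
        using 3[of "fst h" "snd h" g] by (simp add: case_prod_unfold)
    qed
    have 6: "\<forall>A S. A \<subseteq> W \<longrightarrow> S \<subseteq> T \<longrightarrow> avoids A S \<longrightarrow>
        (\<exists>(W', T')\<in>(\<Union>g\<in>\<G>. \<C> g). A \<subseteq> W' \<and> S \<subseteq> T')"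
      using 4 by simp
    show ?thesis
      by (rule exI[of _ "\<Union>g\<in>\<G>. \<C> g"]) (intro conjI 1 2 5 6)
  qed
qed

text \<open>For K > 2, supersaturation gives (K - 2)^2 \<le> K (K - 2) \<le> 8 \<delta> n^2, hence K
  \<le> 2 + sqrt (8 \<delta>) n. Substituting |T| \<ge> s into K bounds |W|.\<close>

lemma card_container_le:
  fixes \<delta> :: real
  assumes \<delta>: "\<delta> > 0" and W: "W \<subseteq> {1..n}" and T: "T \<subseteq> {1..2 * n}"
    and e: "card (sum_pairs W T) \<le> \<delta> * n ^ 2" and s: "s \<le> card T"
  shows "card W \<le> n - s / 2 + 1 + sqrt (8 * \<delta>) * n / 2"
proof -
  define K where "K = 2 * int (card W) + int (card T) - 2 * int n"
  have "real_of_int K \<le> 2 + sqrt (8 * \<delta>) * n"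
  proof (cases "K \<le> 2")
    case True
    moreover have "sqrt (8 * \<delta>) * n \<ge> 0" using \<delta> by simp
    ultimately show ?thesis by linarith
  next
    case False
    then have "K * (K - 2) \<le> 8 * int (card (sum_pairs W T))"
      using sum_pairs_supersaturation[OF W T K_def] by simp
    moreover have "(K - 2) ^ 2 \<le> K * (K - 2)" using False by (simp add: power2_eq_square)
    ultimately have "(K - 2) ^ 2 \<le> 8 * int (card (sum_pairs W T))" by linarith
    then have "real_of_int ((K - 2) ^ 2) \<le> real_of_int (8 * int (card (sum_pairs W T)))"
      by (simp only: of_int_le_iff)
    also have "\<dots> \<le> 8 * \<delta> * n ^ 2" using e by simp
    also have "\<dots> = (sqrt (8 * \<delta>) * n) ^ 2" using \<delta> by (simp add: power_mult_distrib)
    finally have "(real_of_int K - 2) ^ 2 \<le> (sqrt (8 * \<delta>) * n) ^ 2" by simp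
    then have "real_of_int K - 2 \<le> sqrt (8 * \<delta>) * n"
      by (rule power2_le_imp_le) (use \<delta> in simp)
    then show ?thesis by simp
  qed
  then show ?thesis using s by (simp add: K_def)
qed

lemma card_large_sumset_complement_le:
  fixes \<delta> :: real and n d r k s :: nat
  assumes \<delta>: "\<delta> > 0" and d: "d > 0" "d \<le> r" "d \<le> \<delta> * n / 4" and r: "16 * n \<le> \<delta> * d * r"
    and k: "12 \<le> \<delta> * k"
  shows "card {B \<in> Pow {1..n}. s \<le> card ({1..2 * n} - (B + B))} \<le>
    real (card (small_subsets n r)) ^ (2 * k) * 2 powr (n - s / 2 + 1 + sqrt (8 * \<delta>) * n / 2)"
proof -
  let ?w = "n - s / 2 + 1 + sqrt (8 * \<delta>) * n / 2"
  \<comment> \<open>The initial pair has total size n + 2n = 3n and each round removes \<delta> n /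
    4, so 12 / \<delta> rounds suffice.\<close>
  have "12 * real n \<le> \<delta> * k * n" using k by (intro mult_right_mono) auto
  then have "card {1..n} + card {1..2 * n} \<le> k * (\<delta> * n / 4)" by (simp add: mult_ac)
  from container_family[OF \<delta> d r subset_refl subset_refl this] obtain \<C> where
    \<C>: "finite \<C>" "card \<C> \<le> (card (small_subsets n r) ^ 2) ^ k"
      "\<forall>(W, T)\<in>\<C>. W \<subseteq> {1..n} \<and> T \<subseteq> {1..2 * n} \<and> card (sum_pairs W T) \<le> \<delta> * n ^ 2"
      "\<forall>A S. A \<subseteq> {1..n} \<longrightarrow> S \<subseteq> {1..2 * n} \<longrightarrow> avoids A S \<longrightarrow> (\<exists>(W, T)\<in>\<C>. A \<subseteq> W \<and> S \<subseteq> T)"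
    by (elim exE conjE)
  note \<C>_sub = bspec[OF \<C>(3), simplified case_prod_unfold]
  \<comment> \<open>A container of B together with the complement of B + B has |T| \<ge> s, and
    exactly this condition activates the bound on |W|. Containers with smaller T can be
    discarded.\<close>
  define \<C>' where "\<C>' = {g \<in> \<C>. s \<le> card (snd g)}"
  have fC': "finite \<C>'" using \<C>(1) by (simp add: \<C>'_def)
  have sub: "{B \<in> Pow {1..n}. s \<le> card ({1..2 * n} - (B + B))} \<subseteq> (\<Union>g\<in>\<C>'. Pow (fst g))"
  proof
    fix B assume "B \<in> {B \<in> Pow {1..n}. s \<le> card ({1..2 * n} - (B + B))}"
    then have B: "B \<subseteq> {1..n}" "s \<le> card ({1..2 * n} - (B + B))" by auto
    have "avoids B ({1..2 * n} - (B + B))" by (auto simp: avoids_def)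
    then obtain W T where WT: "(W, T) \<in> \<C>" "B \<subseteq> W" "{1..2 * n} - (B + B) \<subseteq> T"
      using \<C>(4)[rule_format, OF B(1), of "{1..2 * n} - (B + B)"] by blast
    have "finite T" using \<C>_sub[OF WT(1)] finite_subset[of T "{1..2 * n}"] by simp
    then have "s \<le> card T" using B(2) card_mono[OF _ WT(3)] by linarith
    then have "(W, T) \<in> \<C>'" using WT by (simp add: \<C>'_def)
    then show "B \<in> (\<Union>g\<in>\<C>'. Pow (fst g))" using WT by force
  qed
  have finW: "finite (fst g)" if "g \<in> \<C>'" for g
    using that \<C>_sub[of g] finite_subset[of "fst g" "{1..n}"] by (simp add: \<C>'_def)
  have "card {B \<in> Pow {1..n}. s \<le> card ({1..2 * n} - (B + B))} \<le> card (\<Union>g\<in>\<C>'. Pow (fst g))"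
    by (rule card_mono[OF _ sub]) (use fC' finW in auto)
  also have "\<dots> \<le> (\<Sum>g\<in>\<C>'. card (Pow (fst g)))" by (rule card_UN_le[OF fC'])
  finally have "real (card {B \<in> Pow {1..n}. s \<le> card ({1..2 * n} - (B + B))}) \<le>
      (\<Sum>g\<in>\<C>'. real (card (Pow (fst g))))"
    unfolding of_nat_sum[symmetric] of_nat_le_iff .
  also have "\<dots> \<le> (\<Sum>g\<in>\<C>'. 2 powr ?w)"
  proof (rule sum_mono)
    fix g assume g: "g \<in> \<C>'"
    have "card (fst g) \<le> ?w"
      by (rule card_container_le[OF \<delta>, of _ _ "snd g"])
        (use g \<C>_sub[of g] in \<open>auto simp: \<C>'_def\<close>)
    then have "2 powr card (fst g) \<le> 2 powr ?w" by simp
    then show "real (card (Pow (fst g))) \<le> 2 powr ?w"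
      using finW[OF g] by (simp add: card_Pow powr_realpow)
  qed
  also have "\<dots> = card \<C>' * 2 powr ?w" by simp
  also have "\<dots> \<le> real ((card (small_subsets n r) ^ 2) ^ k) * 2 powr ?w"
  proof (rule mult_right_mono)
    have "card \<C>' \<le> card \<C>" using \<C>(1) by (intro card_mono) (auto simp: \<C>'_def)
    then show "real (card \<C>') \<le> real ((card (small_subsets n r) ^ 2) ^ k)"
      using \<C>(2) by linarith
  qed simp
  finally show ?thesis by (simp add: power_mult)
qed

text \<open>Choose x so small that (1 + x)^n costs at most half of the exponent \<epsilon> n. The
  factor (1 / x)^r is at most 2^(l r), and the choice of \<eta> fits it into the other half.\<close>

lemma small_subsets_subexponential:
  fixes \<epsilon> :: real
  assumes "\<epsilon> > 0"
  obtains \<eta> :: real where "\<eta> > 0" "\<And>n r. real r \<le> \<eta> * n \<Longrightarrow> card (small_subsets n r) \<le> 2 powr (\<epsilon> * n)"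
proof -
  define x :: real where "x = min 1 (2 powr (\<epsilon> / 2) - 1)"
  have "2 powr (\<epsilon> / 2) > 2 powr 0" using assms by (intro powr_less_mono) auto
  then have x: "0 < x" "x \<le> 1" "1 + x \<le> 2 powr (\<epsilon> / 2)" by (auto simp: x_def)
  \<comment> \<open>The summand 1 keeps l positive even when x = 1, so that \<eta> is well defined
    and positive.\<close>
  define l where "l = log 2 (1 / x) + 1"
  have l: "l \<ge> 1" using x by (simp add: l_def zero_le_log_cancel_iff)
  have xl: "1 / x \<le> 2 powr l" using x by (simp add: l_def powr_add field_simps)
  define \<eta> where "\<eta> = \<epsilon> / (2 * l)"
  have "card (small_subsets n r) \<le> 2 powr (\<epsilon> * n)" if r: "real r \<le> \<eta> * n" for n r
  proof -
    have "card (small_subsets n r) \<le> (1 + x) ^ n / x ^ r" by (rule card_small_subsets_le[OF x(1,2)])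
    also have "\<dots> = (1 + x) ^ n * (1 / x) ^ r" by (simp add: power_one_over)
    also have "\<dots> \<le> (2 powr (\<epsilon> / 2)) ^ n * (2 powr l) ^ r"
      using x xl by (intro mult_mono power_mono) auto
    also have "\<dots> = 2 powr (\<epsilon> / 2 * n + l * r)"
      by (simp add: powr_add powr_realpow[symmetric] powr_powr)
    also have "\<dots> \<le> 2 powr (\<epsilon> * n)"
    proof -
      have "l * r \<le> l * (\<eta> * n)" using r l by (intro mult_left_mono) auto
      then show ?thesis using l by (simp add: \<eta>_def)
    qed
    finally show ?thesis .
  qed
  moreover have "\<eta> > 0" using assms l by (simp add: \<eta>_def)
  ultimately show ?thesis using that by blast
qed

text \<open>The threshold for n is uniform in s, so that n may later be tied to s.\<close>

lemma count_large_sumset_complement: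
  fixes \<epsilon> :: real
  assumes "\<epsilon> > 0"
  shows "\<forall>\<^sub>F n in sequentially. \<forall>s.
    card {B \<in> Pow {1..n}. s \<le> card ({1..2 * n} - (B + B))} \<le> 2 powr (n - s / 2 + \<epsilon> * n)"
proof -
  \<comment> \<open>Three errors get \<epsilon> / 3 each: the square root term through this
    \<delta>, the number of containers through the exponent \<epsilon> / (6k) multiplied by 2k, and
    the additive 1 once n is large.\<close>
  define \<delta> where "\<delta> = \<epsilon> ^ 2 / 18"
  have \<delta>: "\<delta> > 0" using assms by (simp add: \<delta>_def)
  have "sqrt (8 * \<delta>) = sqrt ((2 * \<epsilon> / 3) ^ 2)" by (simp add: \<delta>_def power2_eq_square)
  then have sq: "sqrt (8 * \<delta>) / 2 = \<epsilon> / 3" using assms by simp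
  define k where "k = nat \<lceil>12 / \<delta>\<rceil>"
  have "12 / \<delta> \<le> k" unfolding k_def by linarith
  then have k: "12 \<le> \<delta> * k" using \<delta> by (simp add: field_simps)
  have k0: "k > 0" using k by (cases k) auto
  obtain \<eta> where \<eta>: "\<eta> > 0" "\<And>n r. real r \<le> \<eta> * n \<Longrightarrow> card (small_subsets n r) \<le> 2 powr (\<epsilon> / (6 * k) * n)"
    using small_subsets_subexponential[of "\<epsilon> / (6 * k)"] assms k0 by auto
  \<comment> \<open>d stays constant while r grows like \<eta> n. Since r \<ge> \<eta> n / 2, this d
    gives \<delta> d r \<ge> 16n.\<close>
  define d where "d = nat \<lceil>32 / (\<delta> * \<eta>)\<rceil>"
  have d32: "32 / (\<delta> * \<eta>) \<le> d" unfolding d_def by linarith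
  have "32 / (\<delta> * \<eta>) > 0" using \<delta> \<eta> by simp
  then have d0: "d > 0" using d32 by (cases d) auto
  have ev: "\<forall>\<^sub>F n in sequentially. C \<le> c * real n" if "c > 0" for c C :: real
    using that filterlim_tendsto_pos_mult_at_top[OF tendsto_const that filterlim_real_sequentially]
    by (simp add: filterlim_at_top)
  have "\<forall>\<^sub>F n in sequentially. d + 1 \<le> \<eta> * real n" "\<forall>\<^sub>F n in sequentially. d \<le> \<delta> / 4 * real n"
    "\<forall>\<^sub>F n in sequentially. 1 \<le> \<epsilon> / 3 * real n" "\<forall>\<^sub>F n in sequentially. 2 \<le> \<eta> * real n"
    using ev \<eta> \<delta> assms by auto
  then show ?thesis
  proof eventually_elim
    case (elim n)
    define r where "r = nat \<lfloor>\<eta> * n\<rfloor>"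
    have r: "real r \<le> \<eta> * n" "\<eta> * n / 2 \<le> r" using elim unfolding r_def by linarith+
    have dr: "d \<le> r" using elim unfolding r_def by linarith
    have "16 * n = \<delta> * (32 / (\<delta> * \<eta>)) * (\<eta> * n / 2)" using \<delta> \<eta> by simp
    also have "\<dots> \<le> \<delta> * d * r"
      using \<delta> \<eta> d32 r by (intro mult_mono) auto
    finally have r16: "16 * n \<le> \<delta> * d * r" .
    show ?case
    proof
      fix s
      have "card {B \<in> Pow {1..n}. s \<le> card ({1..2 * n} - (B + B))} \<le>
        real (card (small_subsets n r)) ^ (2 * k) * 2 powr (n - s / 2 + 1 + sqrt (8 * \<delta>) * n / 2)"
        by (rule card_large_sumset_complement_le[OF \<delta> d0 dr _ r16 k]) (use elim in simp)
      also have "\<dots> \<le> (2 powr (\<epsilon> / (6 * k) * n)) ^ (2 * k) * 2 powr (n - s / 2 + 1 + \<epsilon> / 3 * n)"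
        using \<eta>(2)[OF r(1)] sq by (intro mult_mono power_mono) (auto simp: field_simps)
      also have "\<dots> = 2 powr (\<epsilon> / 3 * n + (n - s / 2 + 1 + \<epsilon> / 3 * n))"
      proof -
        have "(2 powr (\<epsilon> / (6 * k) * n)) ^ (2 * k) = 2 powr (\<epsilon> / (6 * k) * n * real (2 * k))"
          by (simp only: powr_realpow[symmetric] powr_powr powr_gt_zero)
        also have "\<epsilon> / (6 * k) * n * real (2 * k) = \<epsilon> / 3 * n" using k0 by simp
        finally show ?thesis by (simp only: powr_add)
      qed
      also have "\<dots> \<le> 2 powr (n - s / 2 + \<epsilon> * n)" using elim by simp
      finally show "card {B \<in> Pow {1..n}. s \<le> card ({1..2 * n} - (B + B))} \<le> 2 powr (n - s / 2 + \<epsilon> * n)" .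
    qed
  qed
qed

section \<open>The random set\<close>

locale random_set = prob_space M for M :: "'a measure" +
  fixes A :: "'a \<Rightarrow> nat set"
  assumes A_pos: "\<omega> \<in> space M \<Longrightarrow> A \<omega> \<subseteq> {1..}"
    and A_indep: "indep_events (\<lambda>n. {\<omega> \<in> space M. n \<in> A \<omega>}) {1..}"
    and A_half: "n \<ge> 1 \<Longrightarrow> prob {\<omega> \<in> space M. n \<in> A \<omega>} = 1 / 2"
begin

section \<open>Cylinder events and their probabilities\<close>

lemma sets_mem [measurable]: "{\<omega> \<in> space M. n \<in> A \<omega>} \<in> events"
proof (cases "n = 0")
  case True
  then have "{\<omega> \<in> space M. n \<in> A \<omega>} = {}" using A_pos by fastforce
  then show ?thesis by (simp only: sets.empty_sets)
next
  case False
  then show ?thesis using A_indep by (auto simp: indep_events_def)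
qed

lemma pred_mem [measurable]: "Measurable.pred M (\<lambda>\<omega>. n \<in> A \<omega>)"
  using sets_mem by (simp add: pred_def)

text \<open>The third condition serves missing sums: with \<open>\<phi> x = z - x\<close> it says
  that no element of \<open>X\<close> takes part in a representation of z.\<close>

definition cylinder :: "nat set \<Rightarrow> nat set \<Rightarrow> nat set \<Rightarrow> (nat \<Rightarrow> nat) \<Rightarrow> 'a set" where
  "cylinder C D X \<phi> =
    {\<omega> \<in> space M. (\<forall>n\<in>C. n \<in> A \<omega>) \<and> (\<forall>n\<in>D. n \<notin> A \<omega>) \<and> (\<forall>x\<in>X. \<not> (x \<in> A \<omega> \<and> \<phi> x \<in> A \<omega>))}"

lemma sets_cylinder [measurable]: "cylinder C D X \<phi> \<in> events"
  unfolding cylinder_def by measurable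

lemma prob_cylinder_pos:
  assumes "finite C" "C \<subseteq> {1..}"
  shows "prob (cylinder C {} {} \<phi>) = (1/2) ^ card C"
proof (cases "C = {}")
  case True
  then show ?thesis by (simp add: cylinder_def prob_space)
next
  case False
  have "cylinder C {} {} \<phi> = (\<Inter>n\<in>C. {\<omega> \<in> space M. n \<in> A \<omega>})"
    using False by (auto simp: cylinder_def)
  then have "prob (cylinder C {} {} \<phi>) = (\<Prod>n\<in>C. prob {\<omega> \<in> space M. n \<in> A \<omega>})"
    using A_indep assms False by (simp add: indep_events_def)
  also have "\<dots> = (\<Prod>n\<in>C. 1/2)" by (rule prod.cong) (use assms A_half in auto)
  finally show ?thesis by (simp add: power_one_over)
qed

text \<open>The event with d excluded is the event without a condition on d minus the one with d
  included. The induction hypothesis covers both, as it holds for every C.\<close>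

lemma prob_cylinder_signed:
  assumes "finite D" "finite C" "C \<union> D \<subseteq> {1..}" "C \<inter> D = {}"
  shows "prob (cylinder C D {} \<phi>) = (1/2) ^ (card C + card D)"
  using assms
proof (induction D arbitrary: C rule: finite_induct)
  case empty
  then show ?case using prob_cylinder_pos by simp
next
  case (insert d D)
  have "cylinder C D {} \<phi> = cylinder C (insert d D) {} \<phi> \<union> cylinder (insert d C) D {} \<phi>"
    "cylinder C (insert d D) {} \<phi> \<inter> cylinder (insert d C) D {} \<phi> = {}"
    by (auto simp: cylinder_def)
  then have "prob (cylinder C D {} \<phi>) =
      prob (cylinder C (insert d D) {} \<phi>) + prob (cylinder (insert d C) D {} \<phi>)"
    by (simp add: finite_measure_Union)
  moreover have "prob (cylinder C D {} \<phi>) = (1/2) ^ (card C + card D)"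
    using insert by auto
  moreover have "prob (cylinder (insert d C) D {} \<phi>) = (1/2) ^ (card (insert d C) + card D)"
    by (rule insert.IH) (use insert in auto)
  moreover have "d \<notin> C" using insert by auto
  ultimately show ?case using insert by simp
qed

text \<open>Split on x. If x is absent, then \<open>\<phi> x\<close> is free; if x is present, then
  \<open>\<phi> x\<close> must be absent. This gives 1/2 + 1/4 = 3/4 per pair, and disjointness of
  the pairs lets the induction continue.\<close>

lemma prob_cylinder:
  assumes "finite X" "finite C" "finite D" "C \<union> D \<union> X \<union> \<phi> ` X \<subseteq> {1..}" "inj_on \<phi> X"
    and "C \<inter> D = {}" "(C \<union> D) \<inter> (X \<union> \<phi> ` X) = {}" "X \<inter> \<phi> ` X = {}"
  shows "prob (cylinder C D X \<phi>) = (1/2) ^ (card C + card D) * (3/4) ^ card X"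
  using assms
proof (induction X arbitrary: C D rule: finite_induct)
  case empty
  then show ?case using prob_cylinder_signed[of D C] by simp
next
  case (insert x X)
  have "cylinder C D (insert x X) \<phi> =
      cylinder C (insert x D) X \<phi> \<union> cylinder (insert x C) (insert (\<phi> x) D) X \<phi>"
    "cylinder C (insert x D) X \<phi> \<inter> cylinder (insert x C) (insert (\<phi> x) D) X \<phi> = {}"
    by (auto simp: cylinder_def)
  then have "prob (cylinder C D (insert x X) \<phi>) =
      prob (cylinder C (insert x D) X \<phi>) + prob (cylinder (insert x C) (insert (\<phi> x) D) X \<phi>)"
    by (simp add: finite_measure_Union)
  moreover have "prob (cylinder C (insert x D) X \<phi>) =
      (1/2) ^ (card C + card (insert x D)) * (3/4) ^ card X"
    by (rule insert.IH) (use insert in auto)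
  moreover have "prob (cylinder (insert x C) (insert (\<phi> x) D) X \<phi>) =
      (1/2) ^ (card (insert x C) + card (insert (\<phi> x) D)) * (3/4) ^ card X"
    by (rule insert.IH) (use insert in auto)
  moreover have "x \<notin> C" "x \<notin> D" "\<phi> x \<notin> D" using insert.prems by auto
  ultimately show ?case using insert by (simp add: power_add algebra_simps)
qed

section \<open>Measurability of the missing set\<close>

lemma mem_sumset_iff: "z \<in> A \<omega> + A \<omega> \<longleftrightarrow> (\<exists>x\<in>{..z}. x \<in> A \<omega> \<and> z - x \<in> A \<omega>)"
proof
  assume "z \<in> A \<omega> + A \<omega>"
  then obtain a b where "a \<in> A \<omega>" "b \<in> A \<omega>" "z = a + b" by (auto elim: set_plus_elim)
  then show "\<exists>x\<in>{..z}. x \<in> A \<omega> \<and> z - x \<in> A \<omega>" by (intro bexI[of _ a]) auto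
next
  assume "\<exists>x\<in>{..z}. x \<in> A \<omega> \<and> z - x \<in> A \<omega>"
  then obtain x where "x \<le> z" "x \<in> A \<omega>" "z - x \<in> A \<omega>" by auto
  then show "z \<in> A \<omega> + A \<omega>" using set_plus_intro[of x "A \<omega>" "z - x" "A \<omega>"] by simp
qed

lemma pred_sumset [measurable]: "Measurable.pred M (\<lambda>\<omega>. z \<in> A \<omega> + A \<omega>)"
  unfolding mem_sumset_iff by measurable

definition missing :: "'a \<Rightarrow> nat set" where
  "missing \<omega> = {1..} - (A \<omega> + A \<omega>)"

text \<open>There are only countably many finite sets S of integers, and each event that the missing
  set equals S is measurable.\<close>

lemma sets_missing_count:
  "{\<omega> \<in> space M. finite (missing \<omega>) \<and> card (missing \<omega>) = s} \<in> events"
proof -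
  have "{\<omega> \<in> space M. finite (missing \<omega>) \<and> card (missing \<omega>) = s} =
      (\<Union>S\<in>{S. finite S \<and> card S = s}. {\<omega> \<in> space M. \<forall>z. z \<in> missing \<omega> \<longleftrightarrow> z \<in> S})"
    unfolding set_eq_iff[symmetric] by auto
  also have "\<dots> \<in> events"
  proof (rule sets.countable_UN'')
    show "countable {S :: nat set. finite S \<and> card S = s}"
      by (rule countable_subset[OF _ countable_Collect_finite]) auto
    show "{\<omega> \<in> space M. \<forall>z. z \<in> missing \<omega> \<longleftrightarrow> z \<in> S} \<in> events" for S
      unfolding missing_def Diff_iff by measurable
  qed
  finally show ?thesis .
qed

section \<open>Geometric bounds for missing integers\<close>

lemma three_quarters_power_le: "(3/4 :: real) ^ (i div 2) \<le> 8/7 * (7/8) ^ i"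
proof -
  have "(3/4 :: real) ^ (i div 2) \<le> ((7/8)^2) ^ (i div 2)"
    by (rule power_mono) (simp_all add: power2_eq_square)
  also have "\<dots> = (7/8) ^ (2 * (i div 2))" by (simp only: power_mult)
  also have "\<dots> \<le> (7/8) ^ i * 8/7"
  proof (cases "even i")
    case False
    then obtain k where "i = 2 * k + 1" by (auto elim: oddE)
    then show ?thesis by simp
  qed simp
  finally show ?thesis by simp
qed

text \<open>Since 3/4 \<le> (7/8)^2, the bounds decay like (7/8)^i, up to a factor 8/7 for rounding
  in \<open>div\<close>. The geometric series sums to 8, and 64/7 \<le> 10.\<close>

lemma prob_union_geometric:
  assumes ev: "\<And>i. F i \<in> events" and F: "\<And>i. prob (F i) \<le> c * (3/4) ^ ((i + k) div 2)" and "c \<ge> 0"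
  shows "prob (\<Union>i::nat. F i) \<le> 10 * c * (7/8) ^ k"
proof -
  have bd: "prob (F i) \<le> c * (8/7) * (7/8) ^ k * (7/8) ^ i" for i
    using order_trans[OF F mult_left_mono[OF three_quarters_power_le \<open>c \<ge> 0\<close>], of i]
    by (simp add: power_add mult_ac)
  have sm: "summable (\<lambda>i. c * (8/7) * (7/8) ^ k * (7/8 :: real) ^ i)"
    by (intro summable_mult summable_geometric) simp
  have sP: "summable (\<lambda>i. prob (F i))"
    by (rule summable_comparison_test'[OF sm]) (use bd in auto)
  have "prob (\<Union>i. F i) \<le> (\<Sum>i. prob (F i))"
    by (rule finite_measure_subadditive_countably) (use ev sP in auto)
  also have "\<dots> \<le> (\<Sum>i. c * (8/7) * (7/8) ^ k * (7/8) ^ i)"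
    by (rule suminf_le[OF bd sP sm])
  also have "\<dots> = c * (8/7) * (7/8) ^ k * 8"
    by (subst suminf_mult) (simp_all add: suminf_geometric)
  also have "\<dots> \<le> 10 * c * (7/8) ^ k"
    using \<open>c \<ge> 0\<close> by simp
  finally show ?thesis .
qed

lemma prob_missing_beyond:
  "prob {\<omega> \<in> space M. \<exists>z>N. z \<in> missing \<omega>} \<le> 10 * (7/8) ^ N"
proof -
  \<comment> \<open>If z = N + i + 1 is missing, each pair (x, z - x) has an absent member. Stopping
    at (N + i) div 2 leaves out the middle element z / 2 of an even z, so the pairs are
    disjoint.\<close>
  define F where "F i = cylinder {} {} {1..(N + i) div 2} (\<lambda>x. N + i + 1 - x)" for i
  have "prob (F i) \<le> 1 * (3/4) ^ ((i + N) div 2)" for i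
    unfolding F_def by (subst prob_cylinder) (auto simp: inj_on_def add.commute)
  then have "prob (\<Union>i. F i) \<le> 10 * 1 * (7/8) ^ N"
    by (intro prob_union_geometric) (auto simp: F_def)
  moreover have "prob {\<omega> \<in> space M. \<exists>z>N. z \<in> missing \<omega>} \<le> prob (\<Union>i. F i)"
  proof (rule finite_measure_mono)
    show "{\<omega> \<in> space M. \<exists>z>N. z \<in> missing \<omega>} \<subseteq> (\<Union>i. F i)"
    proof safe
      fix \<omega> z assume \<omega>: "\<omega> \<in> space M" "z > N" "z \<in> missing \<omega>"
      then have "z = N + (z - N - 1) + 1" by simp
      then have "\<omega> \<in> F (z - N - 1)"
        using \<omega> unfolding F_def cylinder_def missing_def Diff_iff mem_sumset_iff by fastforce
      then show "\<omega> \<in> (\<Union>i. F i)" by blast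
    qed
  qed (auto simp: F_def)
  ultimately show ?thesis by simp
qed

section \<open>Upper bound: reduction to counting finite sets\<close>

lemma trace_eq_UN_cylinder:
  assumes "\<F> \<subseteq> Pow {1..n}"
  shows "{\<omega> \<in> space M. A \<omega> \<inter> {1..n} \<in> \<F>} = (\<Union>B\<in>\<F>. cylinder B ({1..n} - B) {} id)"
proof -
  have "\<omega> \<in> cylinder B ({1..n} - B) {} id \<longleftrightarrow> \<omega> \<in> space M \<and> A \<omega> \<inter> {1..n} = B"
    if "B \<in> \<F>" for \<omega> B
    using assms that by (auto simp: cylinder_def)
  then show ?thesis by auto
qed

lemma prob_trace:
  assumes "\<F> \<subseteq> Pow {1..n}"
  shows "prob {\<omega> \<in> space M. A \<omega> \<inter> {1..n} \<in> \<F>} = card \<F> / 2 ^ n"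
proof -
  have fin: "finite \<F>" using assms finite_subset by blast
  define E where "E B = cylinder B ({1..n} - B) {} id" for B
  have "{\<omega> \<in> space M. A \<omega> \<inter> {1..n} \<in> \<F>} = (\<Union>B\<in>\<F>. E B)"
    unfolding E_def by (rule trace_eq_UN_cylinder[OF assms])
  moreover have "prob (\<Union>B\<in>\<F>. E B) = (\<Sum>B\<in>\<F>. prob (E B))"
  proof (rule finite_measure_finite_Union[OF fin])
    show "disjoint_family_on E \<F>"
      using assms by (auto simp: disjoint_family_on_def E_def cylinder_def) blast+
  qed (auto simp: E_def)
  moreover have "prob (E B) = (1/2) ^ n" if "B \<in> \<F>" for B
  proof -
    have B: "B \<subseteq> {1..n}" "finite B" using assms that finite_subset[OF _ finite_atLeastAtMost] by blast+
    then have "card B + card ({1..n} - B) = n"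
      using card_mono[OF _ B(1)] by (simp add: card_Diff_subset)
    then show ?thesis unfolding E_def using B by (subst prob_cylinder_signed) auto
  qed
  ultimately show ?thesis by (simp add: power_one_over)
qed

text \<open>If nothing beyond n is missing, the missing integers lie in \<open>{1..2 * n}\<close>.
  They also avoid B + B for the trace B of A on \<open>{1..n}\<close>, so B is among the counted
  sets.\<close>

lemma prob_missing_count_le:
  "prob {\<omega> \<in> space M. finite (missing \<omega>) \<and> card (missing \<omega>) = s} \<le>
    card {B \<in> Pow {1..n}. s \<le> card ({1..2 * n} - (B + B))} / 2 ^ n + 10 * (7/8) ^ n"
proof -
  define \<F> where "\<F> = {B \<in> Pow {1..n}. s \<le> card ({1..2 * n} - (B + B))}"
  let ?E = "{\<omega> \<in> space M. A \<omega> \<inter> {1..n} \<in> \<F>}"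
  let ?G = "{\<omega> \<in> space M. \<exists>z>n. z \<in> missing \<omega>}"
  have ev: "?E \<in> events" "?G \<in> events"
  proof -
    have "?E = (\<Union>B\<in>\<F>. cylinder B ({1..n} - B) {} id)"
      by (rule trace_eq_UN_cylinder) (auto simp: \<F>_def)
    also have "\<dots> \<in> events"
      by (rule sets.finite_UN) (auto simp: \<F>_def)
    finally show "?E \<in> events" .
    show "?G \<in> events" unfolding missing_def Diff_iff by measurable
  qed
  have "{\<omega> \<in> space M. finite (missing \<omega>) \<and> card (missing \<omega>) = s} \<subseteq> ?E \<union> ?G"
  proof safe
    fix \<omega> assume \<omega>: "\<omega> \<in> space M" "finite (missing \<omega>)" "s = card (missing \<omega>)"
      and "\<not> (\<exists>z>n. z \<in> missing \<omega>)"
    then have "missing \<omega> \<subseteq> {1..2 * n} - (A \<omega> \<inter> {1..n} + A \<omega> \<inter> {1..n})"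
      unfolding missing_def by (force simp: set_plus_def)
    then have "card (missing \<omega>) \<le> card ({1..2 * n} - (A \<omega> \<inter> {1..n} + A \<omega> \<inter> {1..n}))"
      by (intro card_mono) auto
    then show "A \<omega> \<inter> {1..n} \<in> \<F>" using \<omega>(3) by (simp add: \<F>_def)
  qed
  then have "prob {\<omega> \<in> space M. finite (missing \<omega>) \<and> card (missing \<omega>) = s} \<le> prob (?E \<union> ?G)"
    by (rule finite_measure_mono) (rule sets.Un[OF ev])
  also have "\<dots> \<le> prob ?E + prob ?G" by (rule measure_Un_le[OF ev])
  also have "prob ?E = card \<F> / 2 ^ n" by (rule prob_trace) (auto simp: \<F>_def)
  also have "prob ?G \<le> 10 * (7/8) ^ n" by (rule prob_missing_beyond)
  finally show ?thesis by (simp add: \<F>_def)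
qed

section \<open>Lower bound: a prescribed prefix followed by a full tail\<close>

lemma prob_prefix_full_tail:
  assumes C: "C \<subseteq> {1..<K}" "{K - 5..<K} \<subseteq> C" and K: "K \<ge> 6"
  shows "prob (cylinder C ({1..<K} - C) {} id \<inter> {\<omega>. \<forall>z\<ge>2 * K - 1. z \<notin> missing \<omega>}) \<ge> (1/2) ^ K"
proof -
  define B where "B = cylinder C ({1..<K} - C) {} id"
  have fC: "finite C" using C finite_subset by blast
  have cC: "card C + card ({1..<K} - C) = K - 1"
    using card_mono[OF _ C(1)] fC C(1) by (simp add: card_Diff_subset)
  \<comment> \<open>\<open>F i\<close> contains the event that \<open>2K - 1 + i\<close> is missing: the partners of the five forced elements
    \<open>{K - 5..<K}\<close> are absent, and so is one of each pair inside the disjoint range \<open>{K..<K + i}\<close>.\<close>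
  define F where "F i = cylinder C (({1..<K} - C) \<union> {K + i..<K + i + 5}) {K..<K + i div 2}
      (\<lambda>x. 2 * K - 1 + i - x)" for i
  have "prob (F i) \<le> (1/2) ^ (K - 1) * (1/32) * (3/4) ^ ((i + 0) div 2)" for i
  proof -
    have "card (({1..<K} - C) \<union> {K + i..<K + i + 5}) = card ({1..<K} - C) + 5"
      by (subst card_Un_disjoint) auto
    then have "card C + card (({1..<K} - C) \<union> {K + i..<K + i + 5}) = K - 1 + 5"
      using cC by simp
    moreover have "2 * K - 1 + i - x \<in> {K..<K + i} \<and> x < 2 * K - 1 + i - x" if "x \<in> {K..<K + i div 2}" for x
      using that K by auto
    then have img: "(\<lambda>x. 2 * K - 1 + i - x) ` {K..<K + i div 2} \<subseteq> {K..<K + i}"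
      "{K..<K + i div 2} \<inter> (\<lambda>x. 2 * K - 1 + i - x) ` {K..<K + i div 2} = {}"
      by (blast, fastforce)
    have "prob (F i) = (1/2) ^ (card C + card (({1..<K} - C) \<union> {K + i..<K + i + 5}))
        * (3/4) ^ card {K..<K + i div 2}"
      unfolding F_def
    proof (rule prob_cylinder)
      show "inj_on (\<lambda>x. 2 * K - 1 + i - x) {K..<K + i div 2}"
        using K by (auto simp: inj_on_def)
      show "(C \<union> (({1..<K} - C) \<union> {K + i..<K + i + 5})) \<inter>
          ({K..<K + i div 2} \<union> (\<lambda>x. 2 * K - 1 + i - x) ` {K..<K + i div 2}) = {}"
      proof -
        have "C \<union> (({1..<K} - C) \<union> {K + i..<K + i + 5}) \<subseteq> {..<K} \<union> {K + i..}" using C(1) by auto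
        moreover have "{K..<K + i div 2} \<union> (\<lambda>x. 2 * K - 1 + i - x) ` {K..<K + i div 2} \<subseteq> {K..<K + i}"
          using img(1) by auto
        moreover have "({..<K} \<union> {K + i..}) \<inter> {K..<K + i} = {}" by auto
        ultimately show ?thesis by blast
      qed
      have "{K..<K + i} \<subseteq> {1..}" using K by auto
      then show "C \<union> (({1..<K} - C) \<union> {K + i..<K + i + 5}) \<union> {K..<K + i div 2} \<union>
          (\<lambda>x. 2 * K - 1 + i - x) ` {K..<K + i div 2} \<subseteq> {1..}"
        using C(1) K img(1) by auto
    qed (use C fC img in auto)
    ultimately show ?thesis by (simp add: power_add power_one_over)
  qed
  then have "prob (\<Union>i. F i) \<le> 10 * ((1/2) ^ (K - 1) * (1/32)) * (7/8) ^ 0"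
    by (intro prob_union_geometric) (auto simp: F_def)
  moreover have "prob B = (1/2) ^ (K - 1)"
    unfolding B_def using C fC cC by (subst prob_cylinder_signed) auto
  \<comment> \<open>The five forced elements contribute the factor 1/32 that beats the constant 10
    of the union bound: relative to B the failure probability is at most 10/32, which leaves more
    than one half.\<close>
  ultimately have "(1/2) ^ (K - 1) * (22/32) \<le> prob B - prob (\<Union>i. F i)" by simp
  also have "\<dots> \<le> prob (B - (\<Union>i. F i))"
  proof -
    have "prob B \<le> prob ((B - (\<Union>i. F i)) \<union> (\<Union>i. F i))"
      by (rule finite_measure_mono) (auto simp: B_def F_def)
    also have "\<dots> \<le> prob (B - (\<Union>i. F i)) + prob (\<Union>i. F i)"
      by (intro measure_Un_le) (auto simp: B_def F_def)
    finally show ?thesis by simp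
  qed
  also have "\<dots> \<le> prob (B \<inter> {\<omega>. \<forall>z\<ge>2 * K - 1. z \<notin> missing \<omega>})"
  proof (rule finite_measure_mono)
    show "B - (\<Union>i. F i) \<subseteq> B \<inter> {\<omega>. \<forall>z\<ge>2 * K - 1. z \<notin> missing \<omega>}"
    proof safe
      fix \<omega> z assume \<omega>: "\<omega> \<in> B" "\<omega> \<notin> (\<Union>i. F i)" and z: "2 * K - 1 \<le> z" "z \<in> missing \<omega>"
      define i where "i = z - (2 * K - 1)"
      have zi: "z = 2 * K - 1 + i" using z by (simp add: i_def)
      have no: "\<not> (x \<in> A \<omega> \<and> y \<in> A \<omega>)" if "x + y = z" for x y
        using z(2) that set_plus_intro[of x "A \<omega>" y "A \<omega>"] by (auto simp: missing_def)
      have "y \<notin> A \<omega>" if "y \<in> {K + i..<K + i + 5}" for y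
      proof -
        have "z - y \<in> {K - 5..<K}" using that K zi by auto
        then have "z - y \<in> A \<omega>" using C(2) \<omega>(1) by (auto simp: B_def cylinder_def)
        then show ?thesis using no[of "z - y" y] that zi K by auto
      qed
      moreover have "\<not> (x \<in> A \<omega> \<and> z - x \<in> A \<omega>)" if "x \<in> {K..<K + i div 2}" for x
        using no[of x "z - x"] that zi by auto
      ultimately have "\<omega> \<in> F i"
        using \<omega>(1) zi unfolding F_def B_def cylinder_def by auto
      then show False using \<omega>(2) by blast
    qed
    have "B \<inter> {\<omega>. \<forall>z\<ge>2 * K - 1. z \<notin> missing \<omega>} =
        B \<inter> {\<omega> \<in> space M. \<forall>z. z \<ge> 2 * K - 1 \<longrightarrow> z \<notin> missing \<omega>}"
      by (auto simp: B_def cylinder_def)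
    moreover have "{\<omega> \<in> space M. \<forall>z. z \<ge> 2 * K - 1 \<longrightarrow> z \<notin> missing \<omega>} \<in> events"
      unfolding missing_def Diff_iff by measurable
    moreover have "B \<in> events" by (simp add: B_def sets_cylinder)
    ultimately show "B \<inter> {\<omega>. \<forall>z\<ge>2 * K - 1. z \<notin> missing \<omega>} \<in> events"
      by (simp only: sets.Int)
  qed
  finally have "(1/2) ^ (K - 1) * (22/32) \<le> prob (B \<inter> {\<omega>. \<forall>z\<ge>2 * K - 1. z \<notin> missing \<omega>})" .
  moreover have "(1/2 :: real) ^ K = (1/2) ^ (K - 1) * (1/2)"
    using K by (cases K) auto
  moreover have "(1/2 :: real) ^ (K - 1) > 0" by simp
  ultimately show ?thesis unfolding B_def by linarith
qed

text \<open>The witnessing prefix starts at the minimum \<open>m\<close> of \<open>A\<close>, which makes exactly \<open>1, \<dots>, 2m - 1\<close>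
  miss; for even \<open>s\<close> the element \<open>m + 1\<close> is left out, so that \<open>2m + 1\<close> is missing as well.\<close>
lemma prob_missing_count_ge:
  assumes "s \<ge> 1"
  shows "prob {\<omega> \<in> space M. finite (missing \<omega>) \<and> card (missing \<omega>) = s} \<ge> (1/2) ^ ((s + 1) div 2 + 7)"
proof -
  define m where "m = (s + 1) div 2"
  \<comment> \<open>With this K the five elements from K - 5 = m + 2 to K - 1 lie in
    \<open>C\<close> even when m + 1 is left out.\<close>
  define K where "K = m + 7"
  define C where "C = (if odd s then {m..<K} else {m..<K} - {m + 1})"
  define Z where "Z = (if odd s then {1..<2 * m} else insert (2 * m + 1) {1..<2 * m})"
  have m: "m \<ge> 1" using assms by (simp add: m_def)
  have cZ: "card Z = s"
  proof (cases "odd s")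
    case True
    then have "2 * m = s + 1" by (auto simp: m_def elim: oddE)
    then show ?thesis using True by (simp add: Z_def)
  next
    case False
    then have "2 * m = s" by (auto simp: m_def elim: evenE)
    then show ?thesis using False assms by (simp add: Z_def)
  qed
  have *: "missing \<omega> = Z" if \<omega>: "\<omega> \<in> cylinder C ({1..<K} - C) {} id" "\<forall>z\<ge>2 * K - 1. z \<notin> missing \<omega>" for \<omega>
  proof -
    have CA: "C \<subseteq> A \<omega>" and AC: "A \<omega> \<subseteq> C \<union> {K..}"
      using \<omega>(1) A_pos[of \<omega>] by (force simp: cylinder_def)+
    have "z \<notin> A \<omega> + A \<omega>" if "z \<in> Z" for z
    proof
      assume "z \<in> A \<omega> + A \<omega>"
      then obtain a b where ab: "a \<in> C \<union> {K..}" "b \<in> C \<union> {K..}" "z = a + b"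
        using AC by (auto elim!: set_plus_elim)
      show False
      proof (cases "odd s")
        case True
        then show ?thesis using ab that by (auto simp: Z_def C_def K_def)
      next
        case False
        then have "a \<ge> m" "b \<ge> m" "a \<noteq> m + 1" "b \<noteq> m + 1" using ab by (auto simp: C_def K_def)
        then show ?thesis using ab(3) that False by (auto simp: Z_def)
      qed
    qed
    moreover have "z \<in> A \<omega> + A \<omega>" if z: "z \<ge> 1" "z \<notin> Z" for z
    proof (cases "z \<ge> 2 * K - 1")
      case True
      then show ?thesis using \<omega>(2) z by (auto simp: missing_def)
    next
      case False
      have z2: "z \<ge> 2 * m" using z by (auto simp: Z_def split: if_splits)
      \<comment> \<open>Sums with the least element m reach up to m + K - 1, and sums with the
        largest element K - 1 continue to 2K - 2.\<close>
      have "\<exists>a\<in>C. \<exists>b\<in>C. z = a + b"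
      proof (cases "odd s")
        case True
        show ?thesis
        proof (cases "z < m + K")
          case True
          then show ?thesis using z2 \<open>odd s\<close> m
            by (intro bexI[of _ m] bexI[of _ "z - m"]) (auto simp: C_def K_def)
        next
          case False
          then show ?thesis using \<open>\<not> z \<ge> 2 * K - 1\<close> \<open>odd s\<close> m
            by (intro bexI[of _ "K - 1"] bexI[of _ "z - (K - 1)"]) (auto simp: C_def K_def)
        qed
      next
        case ev: False
        have zn: "z \<noteq> 2 * m + 1" using z ev by (auto simp: Z_def)
        show ?thesis
        proof (cases "z < m + K")
          case True
          then show ?thesis using z2 ev m zn
            by (intro bexI[of _ m] bexI[of _ "z - m"]) (auto simp: C_def K_def)
        next
          case F: False
          show ?thesis
          \<comment> \<open>Here z - (K - 1) is the omitted element m + 1, so this one value needs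
            another decomposition.\<close>
          proof (cases "z = m + K")
            case True
            then show ?thesis using ev m
              by (intro bexI[of _ "K - 2"] bexI[of _ "m + 2"]) (auto simp: C_def K_def)
          next
            case False
            then show ?thesis using \<open>\<not> z \<ge> 2 * K - 1\<close> ev m F
              by (intro bexI[of _ "K - 1"] bexI[of _ "z - (K - 1)"]) (auto simp: C_def K_def)
          qed
        qed
      qed
      then show ?thesis using CA by (auto intro: set_plus_intro)
    qed
    moreover have "Z \<subseteq> {1..}" by (auto simp: Z_def)
    ultimately show ?thesis unfolding missing_def by auto
  qed
  have sub: "cylinder C ({1..<K} - C) {} id \<inter> {\<omega>. \<forall>z\<ge>2 * K - 1. z \<notin> missing \<omega>}
      \<subseteq> {\<omega> \<in> space M. finite (missing \<omega>) \<and> card (missing \<omega>) = s}"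
  proof
    fix \<omega> assume \<omega>: "\<omega> \<in> cylinder C ({1..<K} - C) {} id \<inter> {\<omega>. \<forall>z\<ge>2 * K - 1. z \<notin> missing \<omega>}"
    then have "missing \<omega> = Z" by (intro *) simp_all
    moreover have "finite Z" by (simp add: Z_def)
    moreover have "\<omega> \<in> space M" using \<omega> by (simp add: cylinder_def)
    ultimately show "\<omega> \<in> {\<omega> \<in> space M. finite (missing \<omega>) \<and> card (missing \<omega>) = s}"
      using cZ by simp
  qed
  have "(1/2) ^ K \<le> prob (cylinder C ({1..<K} - C) {} id \<inter> {\<omega>. \<forall>z\<ge>2 * K - 1. z \<notin> missing \<omega>})"
  proof (rule prob_prefix_full_tail)
    show "C \<subseteq> {1..<K}" using m by (auto simp: C_def)
    have "K - 5 = m + 2" by (simp add: K_def)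
    then show "{K - 5..<K} \<subseteq> C" by (auto simp: C_def)
    show "6 \<le> K" by (simp add: K_def)
  qed
  also have "\<dots> \<le> prob {\<omega> \<in> space M. finite (missing \<omega>) \<and> card (missing \<omega>) = s}"
    by (rule finite_measure_mono[OF sub sets_missing_count])
  finally show ?thesis by (simp add: K_def m_def)
qed

end

section \<open>From exponential rates to the base 2 + o(1)\<close>

lemma powr_two_plus_smallo:
  fixes p :: "nat \<Rightarrow> real"
  assumes "\<And>\<epsilon>. \<epsilon> > 0 \<Longrightarrow> \<forall>\<^sub>F s in sequentially. 2 powr (- (1/2 + \<epsilon>) * s) \<le> p s"
    and "\<And>\<epsilon>. \<epsilon> > 0 \<Longrightarrow> \<forall>\<^sub>F s in sequentially. p s \<le> 2 powr (- (1/2 - \<epsilon>) * s)"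
  shows "\<exists>e :: nat \<Rightarrow> real. e \<in> o(\<lambda>_. 1) \<and> (\<forall>\<^sub>F s in sequentially. p s = (2 + e s) powr (- real s / 2))"
proof -
  \<comment> \<open>Solving for the base gives 2 + e s = 2 powr q s, so the claim reduces to q
    tending to 1. The two hypotheses sandwich log 2 (p s), hence q.\<close>
  define q where "q s = - 2 / real s * log 2 (p s)" for s
  define e where "e s = 2 powr q s - 2" for s
  have pos: "\<forall>\<^sub>F s in sequentially. p s > 0"
    using assms(1)[OF zero_less_one]
  proof eventually_elim
    case (elim s)
    have "(0 :: real) < 2 powr (- (1/2 + 1) * s)" by simp
    then show ?case using elim by linarith
  qed
  have "q \<longlonglongrightarrow> 1"
  proof (rule tendstoI)
    fix \<epsilon> :: real assume "\<epsilon> > 0"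
    then have "\<epsilon> / 4 > 0" by simp
    show "\<forall>\<^sub>F s in sequentially. dist (q s) 1 < \<epsilon>"
      using assms(1)[OF \<open>\<epsilon> / 4 > 0\<close>] assms(2)[OF \<open>\<epsilon> / 4 > 0\<close>] pos eventually_gt_at_top[of 0]
    proof eventually_elim
      case (elim s)
      have "log 2 (2 powr (- (1/2 + \<epsilon> / 4) * s)) \<le> log 2 (p s)"
        using elim by (subst log_le_cancel_iff) auto
      then have "- (1/2 + \<epsilon> / 4) * s \<le> log 2 (p s)" by simp
      moreover have "log 2 (p s) \<le> log 2 (2 powr (- (1/2 - \<epsilon> / 4) * s))"
        using elim by (subst log_le_cancel_iff) auto
      then have "log 2 (p s) \<le> - (1/2 - \<epsilon> / 4) * s" by simp
      moreover have "log 2 (p s) = - (real s / 2) * q s" using elim by (simp add: q_def)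
      ultimately have "real s * q s \<le> real s * (1 + \<epsilon> / 2)" "real s * (1 - \<epsilon> / 2) \<le> real s * q s"
        by (simp_all add: algebra_simps)
      then have "q s \<le> 1 + \<epsilon> / 2" "1 - \<epsilon> / 2 \<le> q s" using elim by simp_all
      then show ?case using \<open>\<epsilon> > 0\<close> by (simp add: dist_real_def abs_if)
    qed
  qed
  then have "(\<lambda>s. 2 powr q s) \<longlonglongrightarrow> 2 powr 1" by (intro tendsto_powr tendsto_const) auto
  then have "e \<longlonglongrightarrow> 0" unfolding e_def by (simp add: LIM_zero_iff)
  then have "e \<in> o(\<lambda>_. 1)" by (intro smalloI_tendsto) auto
  moreover have "\<forall>\<^sub>F s in sequentially. p s = (2 + e s) powr (- real s / 2)"
    using pos eventually_gt_at_top[of 0]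
  proof eventually_elim
    case (elim s)
    have "(2 + e s) powr (- real s / 2) = 2 powr (q s * (- real s / 2))"
      by (simp add: e_def powr_powr)
    also have "q s * (- real s / 2) = log 2 (p s)" using elim by (simp add: q_def)
    finally show ?case using elim by simp
  qed
  ultimately show ?thesis by blast
qed

context random_set begin

lemma prob_missing_count_lower:
  assumes "\<epsilon> > 0"
  shows "\<forall>\<^sub>F s in sequentially. 2 powr (- (1/2 + \<epsilon>) * s) \<le>
    prob {\<omega> \<in> space M. finite (missing \<omega>) \<and> card (missing \<omega>) = s}"
proof -
  have "\<forall>\<^sub>F s in sequentially. 8 \<le> \<epsilon> * real s"
    using filterlim_tendsto_pos_mult_at_top[OF tendsto_const assms filterlim_real_sequentially]
    by (simp add: filterlim_at_top)
  then show ?thesis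
    using eventually_ge_at_top[of 1]
  proof eventually_elim
    case (elim s)
    have "2 powr (- (1/2 + \<epsilon>) * s) \<le> 2 powr (- real ((s + 1) div 2 + 7))"
    proof -
      \<comment> \<open>The bound 8 \<le> \<epsilon> s absorbs the extra 7 in the exponent and the
        1/2 from (s + 1) / 2.\<close>
      have "real ((s + 1) div 2) \<le> (s + 1) / 2" using of_nat_div_le_of_nat[of "s + 1" 2, where 'a = real] by simp
      then show ?thesis using elim by (simp add: algebra_simps)
    qed
    also have "\<dots> = (1/2) ^ ((s + 1) div 2 + 7)"
      by (simp only: powr_minus powr_realpow power_one_over inverse_eq_divide)
    also have "\<dots> \<le> prob {\<omega> \<in> space M. finite (missing \<omega>) \<and> card (missing \<omega>) = s}"
      by (rule prob_missing_count_ge[OF elim(2)])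
    finally show ?case .
  qed
qed

lemma prob_missing_count_upper:
  assumes "\<epsilon> > 0"
  shows "\<forall>\<^sub>F s in sequentially. prob {\<omega> \<in> space M. finite (missing \<omega>) \<and> card (missing \<omega>) = s}
    \<le> 2 powr (- (1/2 - \<epsilon>) * s)"
proof -
  have "\<forall>\<^sub>F s in sequentially. 8 \<le> \<epsilon> * real s"
    using filterlim_tendsto_pos_mult_at_top[OF tendsto_const assms filterlim_real_sequentially]
    by (simp add: filterlim_at_top)
  \<comment> \<open>The count is used along n = 8s. The error \<epsilon> / 16 per unit of n then
    becomes \<epsilon> s / 2.\<close>
  moreover have "\<forall>\<^sub>F s in sequentially. \<forall>t. card {B \<in> Pow {1..8 * s}. t \<le> card ({1..2 * (8 * s)} - (B + B))}
      \<le> 2 powr (real (8 * s) - t / 2 + \<epsilon> / 16 * real (8 * s))"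
    by (rule eventually_compose_filterlim[OF count_large_sumset_complement])
      (use assms in \<open>auto intro!: filterlim_subseq strict_monoI\<close>)
  ultimately show ?thesis
  proof eventually_elim
    case (elim s)
    let ?x = "2 powr (- real s / 2 + \<epsilon> / 2 * s)"
    have "prob {\<omega> \<in> space M. finite (missing \<omega>) \<and> card (missing \<omega>) = s} \<le>
        card {B \<in> Pow {1..8 * s}. s \<le> card ({1..2 * (8 * s)} - (B + B))} / 2 ^ (8 * s) + 10 * (7/8) ^ (8 * s)"
      by (rule prob_missing_count_le)
    also have "\<dots> \<le> ?x + 10 * ?x"
    proof (rule add_mono)
      have "card {B \<in> Pow {1..8 * s}. s \<le> card ({1..2 * (8 * s)} - (B + B))} / 2 ^ (8 * s)
          \<le> 2 powr (real (8 * s) - s / 2 + \<epsilon> / 16 * real (8 * s)) / 2 powr real (8 * s)"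
        unfolding powr_realpow[OF zero_less_numeral]
        by (rule divide_right_mono[OF elim(2)[rule_format]]) simp
      also have "\<dots> = ?x" by (simp only: powr_diff[symmetric]) simp
      finally show "card {B \<in> Pow {1..8 * s}. s \<le> card ({1..2 * (8 * s)} - (B + B))} / 2 ^ (8 * s) \<le> ?x" .
      have "(7/8 :: real) ^ (8 * s) = ((7/8) ^ 8) ^ s" by (rule power_mult)
      \<comment> \<open>This explains the factor 8: (7/8)^8 \<le> 1/2 pushes the tail below 2^(-s),
        well under the main term.\<close>
      also have "\<dots> \<le> (1/2) ^ s" by (rule power_mono) (simp_all add: power_divide)
      also have "\<dots> = 2 powr (- real s)"
        by (simp add: powr_minus powr_realpow power_one_over inverse_eq_divide)
      also have "\<dots> \<le> ?x" using elim(1) by simp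
      finally show "10 * (7/8) ^ (8 * s) \<le> 10 * ?x" by simp
    qed
    \<comment> \<open>The total factor 11 is at most 2^4, and 4 \<le> \<epsilon> s / 2 absorbs it
      into the remaining half of the error.\<close>
    also have "\<dots> \<le> 2 powr 4 * ?x" by simp
    also have "\<dots> = 2 powr (4 + (- real s / 2 + \<epsilon> / 2 * s))" by (simp only: powr_add)
    also have "\<dots> \<le> 2 powr (- (1/2 - \<epsilon>) * s)" using elim(1) by (simp add: algebra_simps)
    finally show ?case .
  qed
qed

end

theorem theorem1p3:
  fixes M :: "'a measure" and A :: "'a \<Rightarrow> nat set"
  assumes "prob_space M"
    and "\<And>\<omega>. \<omega> \<in> space M \<Longrightarrow> A \<omega> \<subseteq> {1..}"
    and "prob_space.indep_events M (\<lambda>n. {\<omega> \<in> space M. n \<in> A \<omega>}) {1..}"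
    and "\<And>n. n \<ge> 1 \<Longrightarrow> measure M {\<omega> \<in> space M. n \<in> A \<omega>} = 1 / 2"
  shows "\<exists>e :: nat \<Rightarrow> real. e \<in> o(\<lambda>_. 1) \<and>
    (\<forall>\<^sub>F s in sequentially.
      measure M {\<omega> \<in> space M. finite ({1..} - (A \<omega> + A \<omega>)) \<and> card ({1..} - (A \<omega> + A \<omega>)) = s}
        = (2 + e s) powr (- real s / 2))"
proof -
  interpret prob_space M by fact
  interpret random_set M A
    using assms(2-4) by unfold_locales
  show ?thesis
    using powr_two_plus_smallo[OF prob_missing_count_lower prob_missing_count_upper]
    unfolding missing_def .
qed

end
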